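(* Any single-round randomized protocol that approximates $\textsc{Set Cover}(U,\mathcal{F})$ within a factor better than $3/2$ with error probability $O(m^{-c})$ requires $\Omega(mn)$ bits of communication, where $n=|U|$, $m=|\mathcal{F}|$, and $c$ is a sufficiently large constant.
   Context: Two-party Set Cover: a ground set $U$ is known to both parties Alice and Bob; Alice holds a family $\mathcal{F}_A$ of subsets of $U$ and Bob holds a family $\mathcal{F}_B$ of subsets of $U$, with $\mathcal{F}=\mathcal{F}_A\cup\mathcal{F}_B$. The goal is to find a minimum-size subfamily of $\mathcal{F}$ whose union is $U$. In a single-round protocol, Alice sends one message (using private randomness) to Bob, and Bob then outputs the solution; the cost is the number of bits of the message.
   Formalization: It is assumed that n ≥ γ·log₂ m for some constant γ > 1 (the Ω-constant may depend on γ); without this the bound fails, e.g. for m = 2^n the family is all subsets of U and no communication is needed, and it fails whenever n/log₂ m → 1. *)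

theory Defs
  imports "HOL-Probability.Probability"
begin

definition is_set_cover :: "'a set \<Rightarrow> 'a set set \<Rightarrow> 'a set set \<Rightarrow> bool" where
  "is_set_cover U F C \<longleftrightarrow> C \<subseteq> F \<and> \<Union>C = U"

definition opt_cover :: "'a set \<Rightarrow> 'a set set \<Rightarrow> nat" where
  "opt_cover U F = (LEAST k. \<exists>C. is_set_cover U F C \<and> card C = k)"

definition approx_cover :: "real \<Rightarrow> 'a set \<Rightarrow> 'a set set \<Rightarrow> 'a set set \<Rightarrow> bool" where
  "approx_cover \<alpha> U F C \<longleftrightarrow>
     is_set_cover U F C \<and> real (card C) \<le> \<alpha> * real (opt_cover U F)"

text \<open>Two-party inputs (Alice's family, Bob's family) with \<open>m\<close> sets in total. The last condition
  says that a cover exists, since otherwise no output is a solution. The two families may overlap.\<close>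

definition instances :: "'a set \<Rightarrow> nat \<Rightarrow> ('a set set \<times> 'a set set) set" where
  "instances U m =
     {(FA, FB). FA \<subseteq> Pow U \<and> FB \<subseteq> Pow U \<and> card (FA \<union> FB) = m \<and> \<Union>(FA \<union> FB) = U}"

text \<open>A single-round private-coin protocol for a fixed ground set and a fixed number of sets
  (so it may depend on both). Private randomness is represented by the distribution of Alice's
  message given her input, and by the distribution of Bob's output given his input and the
  message. Deterministic players are the special case of point distributions.\<close>

record 'a one_way_protocol =
  alice :: "'a set set \<Rightarrow> bool list pmf"
  bob :: "'a set set \<Rightarrow> bool list \<Rightarrow> 'a set set pmf"

definition run :: "'a one_way_protocol \<Rightarrow> 'a set set \<Rightarrow> 'a set set \<Rightarrow> 'a set set pmf" where
  "run P FA FB = bind_pmf (alice P FA) (bob P FB)"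

definition approximates ::
    "'a one_way_protocol \<Rightarrow> 'a set \<Rightarrow> nat \<Rightarrow> real \<Rightarrow> real \<Rightarrow> bool" where
  "approximates P U m \<alpha> \<epsilon> \<longleftrightarrow>
     (\<forall>(FA, FB) \<in> instances U m.
        measure_pmf.prob (run P FA FB) {C. \<not> approx_cover \<alpha> U (FA \<union> FB) C} \<le> \<epsilon>)"

text \<open>Worst-case number of bits, over all inputs and all coin tosses; possibly infinite.\<close>

definition comm_cost :: "'a one_way_protocol \<Rightarrow> 'a set \<Rightarrow> nat \<Rightarrow> enat" where
  "comm_cost P U m =
     (SUP (FA, FB) \<in> instances U m. SUP msg \<in> set_pmf (alice P FA). enat (length msg))"

end

theory Submission
  imports Defs "HOL-Real_Asymp.Real_Asymp"
begin

text \<open>Bob's output exhibits the cover, so a single query can reveal a whole set of Alice. Split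
  \<open>U\<close> into a label part \<open>L\<close>, a data part \<open>R\<close> and one further point \<open>z\<close>. Alice holds the sets
  \<open>e \<union> X e\<close>, where \<open>e\<close> ranges over an antichain \<open>E\<close> of \<open>m - 1\<close> subsets of \<open>L\<close> and \<open>X e \<subseteq> R\<close> is
  arbitrary; Bob holds only \<open>U - e\<close>. The unique cover with at most two sets is
  \<open>{U - e, e \<union> X e}\<close>: the point \<open>z\<close> forces Bob's set into the cover, and the antichain property
  determines its partner. By a union bound over the \<open>m - 1\<close> queries, for each \<open>X\<close> some message
  makes every query succeed with probability above \<open>1/2\<close>, and such a message determines \<open>X\<close>.
  Hence there are at least \<open>2 ^ ((m - 1) * card R)\<close> messages. Since \<open>C(2k,k)\<close> is close to \<open>4^k\<close>
  and \<open>\<gamma> > 1\<close>, the set \<open>L\<close> can be chosen so that \<open>R\<close> keeps a constant fraction of \<open>U\<close>.\<close>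

section \<open>From small error to an injective choice of messages\<close>

lemma measure_bind_pmf_eq_expectation:
  "measure_pmf.prob (bind_pmf p f) A = measure_pmf.expectation p (\<lambda>w. measure_pmf.prob (f w) A)"
proof -
  have "ennreal (measure_pmf.prob (bind_pmf p f) A) = (\<integral>\<^sup>+w. emeasure (measure_pmf (f w)) A \<partial>measure_pmf p)"
    by (simp flip: measure_pmf.emeasure_eq_measure add: emeasure_bind_pmf)
  also have "\<dots> = (\<integral>\<^sup>+w. ennreal (measure_pmf.prob (f w) A) \<partial>measure_pmf p)"
    by (simp add: measure_pmf.emeasure_eq_measure)
  also have "\<dots> = ennreal (measure_pmf.expectation p (\<lambda>w. measure_pmf.prob (f w) A))"
    by (intro nn_integral_eq_integral measure_pmf.integrable_const_bound[where B = 1]) auto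
  finally show ?thesis
    by (simp add: integral_nonneg_AE)
qed

text \<open>Averaging: if every message failed some query with probability at least 1/2, the
  expected sum of the failure probabilities would be at least 1/2, but by linearity it is at most
  \<open>card I * \<epsilon>\<close>.\<close>

lemma exists_message_all_queries_likely:
  fixes p :: "'w pmf" and B :: "'i \<Rightarrow> 'w \<Rightarrow> 'o pmf"
  assumes fin: "finite I"
    and err: "\<And>i. i \<in> I \<Longrightarrow> measure_pmf.prob (bind_pmf p (B i)) {x. x \<noteq> f i} \<le> \<epsilon>"
    and small: "real (card I) * \<epsilon> < 1 / 2"
  shows "\<exists>w \<in> set_pmf p. \<forall>i \<in> I. measure_pmf.prob (B i w) {x. x \<noteq> f i} < 1 / 2"
proof (rule ccontr)
  assume contr: "\<not> ?thesis"
  define S where "S w = (\<Sum>i\<in>I. measure_pmf.prob (B i w) {x. x \<noteq> f i})" for w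
  have int: "integrable (measure_pmf p) (\<lambda>w. measure_pmf.prob (B i w) {x. x \<noteq> f i})" for i
    by (intro measure_pmf.integrable_const_bound[where B = 1]) auto
  have ge: "1 / 2 \<le> S w" if w: "w \<in> set_pmf p" for w
  proof -
    obtain i where i: "i \<in> I" "1 / 2 \<le> measure_pmf.prob (B i w) {x. x \<noteq> f i}"
      using contr w by (meson not_le)
    have "measure_pmf.prob (B i w) {x. x \<noteq> f i} \<le> S w"
      unfolding S_def by (rule member_le_sum[OF i(1)]) (use fin in auto)
    with i(2) show ?thesis by linarith
  qed
  have "1 / 2 \<le> measure_pmf.expectation p S"
  proof (rule measure_pmf.integral_ge_const)
    show "integrable (measure_pmf p) S"
      unfolding S_def by (intro Bochner_Integration.integrable_sum int)
    show "AE w in measure_pmf p. 1 / 2 \<le> S w"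
      using ge by (simp add: AE_measure_pmf_iff)
  qed
  also have "measure_pmf.expectation p S =
      (\<Sum>i\<in>I. measure_pmf.prob (bind_pmf p (B i)) {x. x \<noteq> f i})"
    unfolding S_def measure_bind_pmf_eq_expectation
    by (intro Bochner_Integration.integral_sum int)
  also have "\<dots> \<le> (\<Sum>i\<in>I. \<epsilon>)"
    by (intro sum_mono err)
  finally show False using small by simp
qed

lemma pmf_majority_unique:
  assumes "measure_pmf.prob q {x. x \<noteq> a} < 1 / 2" "measure_pmf.prob q {x. x \<noteq> b} < 1 / 2"
  shows "a = b"
proof (rule ccontr)
  assume "a \<noteq> b"
  then have "{x. x \<noteq> a} \<union> {x. x \<noteq> b} = UNIV" by auto
  moreover have "measure_pmf.prob q ({x. x \<noteq> a} \<union> {x. x \<noteq> b})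
      \<le> measure_pmf.prob q {x. x \<noteq> a} + measure_pmf.prob q {x. x \<noteq> b}"
    by (rule measure_Un_le) auto
  ultimately have "1 \<le> measure_pmf.prob q {x. x \<noteq> a} + measure_pmf.prob q {x. x \<noteq> b}"
    by simp
  with assms show False by linarith
qed

text \<open>A message that is good for all queries fixes each answer as the majority value of Bob's
  output, whatever his coins; by \<open>sep\<close> these answers fix \<open>x\<close>.\<close>

lemma one_way_injective_encoding:
  fixes A :: "'x \<Rightarrow> 'w pmf" and B :: "'i \<Rightarrow> 'w \<Rightarrow> 'o pmf"
  assumes fin: "finite I"
    and err: "\<And>x i. x \<in> S \<Longrightarrow> i \<in> I \<Longrightarrow>
      measure_pmf.prob (bind_pmf (A x) (B i)) {y. y \<noteq> f x i} \<le> \<epsilon>"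
    and small: "real (card I) * \<epsilon> < 1 / 2"
    and sep: "\<And>x y. x \<in> S \<Longrightarrow> y \<in> S \<Longrightarrow> (\<And>i. i \<in> I \<Longrightarrow> f x i = f y i) \<Longrightarrow> x = y"
  shows "\<exists>g. inj_on g S \<and> (\<forall>x \<in> S. g x \<in> set_pmf (A x))"
proof -
  have "\<forall>x \<in> S. \<exists>w. w \<in> set_pmf (A x) \<and>
      (\<forall>i \<in> I. measure_pmf.prob (B i w) {y. y \<noteq> f x i} < 1 / 2)"
  proof
    fix x assume "x \<in> S"
    from exists_message_all_queries_likely[of I "A x" B "f x" \<epsilon>, OF fin err[OF this] small]
    show "\<exists>w. w \<in> set_pmf (A x) \<and>
      (\<forall>i \<in> I. measure_pmf.prob (B i w) {y. y \<noteq> f x i} < 1 / 2)" by blast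
  qed
  then obtain g where g: "\<And>x. x \<in> S \<Longrightarrow> g x \<in> set_pmf (A x)"
    and likely: "\<And>x i. x \<in> S \<Longrightarrow> i \<in> I \<Longrightarrow>
      measure_pmf.prob (B i (g x)) {y. y \<noteq> f x i} < 1 / 2"
    by metis
  have "inj_on g S"
    by (intro inj_onI sep) (metis likely pmf_majority_unique)+
  with g show ?thesis by blast
qed

lemma card_bool_lists_length_le:
  "card {w :: bool list. length w \<le> T} < 2 ^ Suc T"
proof -
  have "card {w :: bool list. length w \<le> T} = (\<Sum>i\<le>T. 2 ^ i)"
    using card_lists_length_le[of "UNIV :: bool set" T] by simp
  also have "\<dots> < 2 ^ Suc T"
    by (induction T) auto
  finally show ?thesis .
qed

text \<open>Messages of all lengths up to \<open>T\<close> count, fewer than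
  \<open>2 ^ Suc T\<close> in total; strictness of this bound saves the last bit.\<close>

lemma length_ge_if_injective:
  fixes g :: "'x \<Rightarrow> bool list"
  assumes "inj_on g S" "\<And>x. x \<in> S \<Longrightarrow> length (g x) \<le> T" "2 ^ b \<le> card S"
  shows "b \<le> T"
proof -
  have fin: "finite {w :: bool list. length w \<le> T}"
    using finite_lists_length_le[of "UNIV :: bool set" T] by simp
  have "2 ^ b \<le> card (g ` S)"
    using assms by (simp add: card_image)
  also have "\<dots> \<le> card {w :: bool list. length w \<le> T}"
    using assms(2) by (intro card_mono fin) auto
  also have "\<dots> < 2 ^ Suc T"
    by (rule card_bool_lists_length_le)
  finally have "(2::nat) ^ b < 2 ^ Suc T" .
  then show ?thesis
    using power_less_imp_less_exp[of "2::nat" b "Suc T"] by simp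
qed

section \<open>Set Cover instances that encode arbitrary data\<close>

lemma approx_cover_card_le_2:
  assumes "finite U" "F \<subseteq> Pow U" "\<alpha> < 3 / 2"
    and "is_set_cover U F {A, B}" "approx_cover \<alpha> U F C"
  shows "card C \<le> 2"
proof -
  have "opt_cover U F \<le> card {A, B}"
    unfolding opt_cover_def using assms(4) by (intro Least_le) blast
  also have "\<dots> \<le> 2" by (simp add: card_insert_if)
  finally have opt: "opt_cover U F \<le> 2" .
  have "real (card C) \<le> \<alpha> * real (opt_cover U F)"
    using assms(5) by (simp add: approx_cover_def)
  \<comment> \<open>An optimum of at most 2 with a factor below 3/2 leaves room for fewer than 3
    sets. The \<open>max\<close> covers negative \<open>\<alpha>\<close>, for which the product is
    not monotone in the optimum.\<close>
  also have "\<dots> \<le> max \<alpha> 0 * 2"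
    using opt by (intro mult_mono) auto
  also have "\<dots> < 3" using assms(3) by (simp add: max_def)
  finally show ?thesis by simp
qed

locale labelled_instance =
  fixes U L R :: "'a set" and z :: 'a and E :: "'a set set"
  assumes finU: "finite U"
    and LU: "L \<subseteq> U" and RU: "R \<subseteq> U" and LR: "L \<inter> R = {}"
    and zU: "z \<in> U" and zL: "z \<notin> L" and zR: "z \<notin> R"
    and EL: "E \<subseteq> Pow L" and nonempty: "{} \<notin> E"
    and antichain: "\<And>d e. d \<in> E \<Longrightarrow> e \<in> E \<Longrightarrow> e \<subseteq> d \<Longrightarrow> d = e"
begin

definition alice_sets :: "('a set \<Rightarrow> 'a set) \<Rightarrow> 'a set set" where
  "alice_sets X = (\<lambda>e. e \<union> X e) ` E"

text \<open>Extensional functions, since values outside \<open>E\<close> never reach Alice's sets: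
  they could be neither counted nor recovered.\<close>

definition data :: "('a set \<Rightarrow> 'a set) set" where
  "data = (\<Pi>\<^sub>E e\<in>E. Pow R)"

lemma data_subset: "X \<in> data \<Longrightarrow> e \<in> E \<Longrightarrow> X e \<subseteq> R"
  by (auto simp: data_def PiE_iff)

lemma finite_E: "finite E"
  using finite_subset[OF LU finU] EL by (meson finite_Pow_iff finite_subset)

lemma card_data: "card data = 2 ^ (card E * card R)"
  using finite_subset[OF RU finU]
  by (simp add: data_def card_PiE finite_E card_Pow mult.commute flip: power_mult)

lemma alice_sets_subset: "X \<in> data \<Longrightarrow> A \<in> alice_sets X \<Longrightarrow> A \<subseteq> U - {z}"
  unfolding alice_sets_def using data_subset EL LU RU zL zR by blast

text \<open>The trace on \<open>L\<close> recovers the label because the data avoid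
  \<open>L\<close>; so distinct labels give distinct sets, and inclusions can be tested on
  labels.\<close>

lemma label_of_union:
  assumes "X \<in> data" "e \<in> E"
  shows "(e \<union> X e) \<inter> L = e"
  using assms data_subset[OF assms] EL LR by auto

lemma card_alice_sets: "X \<in> data \<Longrightarrow> card (alice_sets X) = card E"
  unfolding alice_sets_def by (intro card_image inj_onI) (metis label_of_union)

lemma query_notin_alice_sets:
  assumes "X \<in> data" "e \<in> E"
  shows "U - e \<notin> alice_sets X"
  using alice_sets_subset[OF assms(1)] zU zL EL assms(2) by blast

lemma pair_covers:
  assumes "X \<in> data" "e \<in> E"
  shows "(U - e) \<union> (e \<union> X e) = U"
  using data_subset[OF assms] EL LU RU assms(2) by blast

text \<open>Bob's set contains \<open>z\<close>, so it differs from all of Alice's sets and adds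
  exactly one to the count.\<close>

lemma in_instances:
  assumes "X \<in> data" "e \<in> E"
  shows "(alice_sets X, {U - e}) \<in> instances U (Suc (card E))"
proof -
  have "card (alice_sets X \<union> {U - e}) = Suc (card E)"
    using query_notin_alice_sets[OF assms] card_alice_sets[OF assms(1)] finite_E
    by (simp add: alice_sets_def)
  moreover have "\<Union>(alice_sets X \<union> {U - e}) = U"
  proof
    show "\<Union>(alice_sets X \<union> {U - e}) \<subseteq> U"
      using alice_sets_subset[OF assms(1)] by blast
    have "e \<union> X e \<in> alice_sets X"
      using assms(2) by (simp add: alice_sets_def)
    then show "U \<subseteq> \<Union>(alice_sets X \<union> {U - e})"
      using pair_covers[OF assms] by blast
  qed
  ultimately show ?thesis
    using alice_sets_subset[OF assms(1)] by (auto simp: instances_def)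
qed

lemma approx_cover_unique:
  assumes X: "X \<in> data" and e: "e \<in> E" and \<alpha>: "\<alpha> < 3 / 2"
    and C: "approx_cover \<alpha> U (alice_sets X \<union> {U - e}) C"
  shows "C = {U - e, e \<union> X e}"
proof -
  let ?F = "alice_sets X \<union> {U - e}"
  have sub: "?F \<subseteq> Pow U" using alice_sets_subset[OF X] by blast
  have "is_set_cover U ?F {U - e, e \<union> X e}"
    using pair_covers[OF X e] e by (auto simp: is_set_cover_def alice_sets_def)
  from approx_cover_card_le_2[OF finU sub \<alpha> this C] have card: "card C \<le> 2" .
  have CF: "C \<subseteq> ?F" and CU: "\<Union>C = U"
    using C by (auto simp: approx_cover_def is_set_cover_def)
  have finC: "finite C"
    using finite_subset[OF CF] finite_E by (simp add: alice_sets_def)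
  have query: "U - e \<in> C"
  proof (rule ccontr)
    assume "U - e \<notin> C"
    then have "C \<subseteq> alice_sets X" using CF by blast
    then have "\<Union>C \<subseteq> U - {z}" using alice_sets_subset[OF X] by blast
    then show False using CU zU by blast
  qed
  \<comment> \<open>Bob's set misses \<open>x\<close>, so the cover has a second set
    \<open>A\<close>, and there is no room for a third.\<close>
  obtain x where x: "x \<in> e" using e nonempty by fastforce
  have "x \<in> U" using x e EL LU by auto
  then obtain A where A: "A \<in> C" "x \<in> A" using CU by auto
  then have neq: "A \<noteq> U - e" using x by auto
  have "C = {U - e, A}"
  proof (rule card_seteq[symmetric, OF finC])
    show "{U - e, A} \<subseteq> C" using query A by auto
    show "card C \<le> card {U - e, A}" using neq card by auto
  qed
  moreover obtain d where d: "d \<in> E" "A = d \<union> X d"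
    using A neq CF by (auto simp: alice_sets_def)
  \<comment> \<open>\<open>U - e\<close> misses all of \<open>e\<close>, so \<open>A\<close> alone
    has to contain it.\<close>
  moreover have "e \<subseteq> A"
    using calculation(1) CU e EL LU by auto
  then have "e \<subseteq> d"
    using label_of_union[OF X d(1)] d(2) e EL by auto
  then have "d = e" using antichain d(1) e by blast
  ultimately show ?thesis by simp
qed

lemma comm_cost_ge:
  assumes approx: "approximates P U (Suc (card E)) \<alpha> \<epsilon>" and \<alpha>: "\<alpha> < 3 / 2"
    and small: "real (card E) * \<epsilon> < 1 / 2" and "E \<noteq> {}"
  shows "enat (card E * card R) \<le> comm_cost P U (Suc (card E))"
proof (cases "comm_cost P U (Suc (card E))")
  case (enat T)
  have "\<exists>g. inj_on g data \<and> (\<forall>X \<in> data. g X \<in> set_pmf (alice P (alice_sets X)))"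
  \<comment> \<open>Alice's input depends only on \<open>X\<close> and Bob's only on
    \<open>e\<close>, so one message has to serve all queries.\<close>
  proof (rule one_way_injective_encoding[where I = E and S = data
        and A = "\<lambda>X. alice P (alice_sets X)" and B = "\<lambda>e. bob P {U - e}"
        and f = "\<lambda>X e. {U - e, e \<union> X e}" and \<epsilon> = \<epsilon>])
    show "finite E" by (rule finite_E)
    show "real (card E) * \<epsilon> < 1 / 2" by (rule small)
  next
    fix X e assume Xe: "X \<in> data" "e \<in> E"
    have "measure_pmf.prob (run P (alice_sets X) {U - e}) {C. C \<noteq> {U - e, e \<union> X e}}
        \<le> measure_pmf.prob (run P (alice_sets X) {U - e})
            {C. \<not> approx_cover \<alpha> U (alice_sets X \<union> {U - e}) C}"
      using approx_cover_unique[OF Xe \<alpha>] by (intro measure_pmf.finite_measure_mono) auto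
    also have "\<dots> \<le> \<epsilon>"
      using approx in_instances[OF Xe] by (auto simp: approximates_def)
    finally show "measure_pmf.prob (bind_pmf (alice P (alice_sets X)) (bob P {U - e}))
        {C. C \<noteq> {U - e, e \<union> X e}} \<le> \<epsilon>"
      by (simp add: run_def)
  next
    fix X Y assume XY: "X \<in> data" "Y \<in> data"
      and eq: "\<And>e. e \<in> E \<Longrightarrow> {U - e, e \<union> X e} = {U - e, e \<union> Y e}"
    show "X = Y"
    proof (rule PiE_ext[OF XY[unfolded data_def]])
      fix e assume e: "e \<in> E"
      have "e \<union> X e = e \<union> Y e"
        using eq[OF e] by (metis doubleton_eq_iff)
      then show "X e = Y e"
        using data_subset[OF XY(1) e] data_subset[OF XY(2) e] e EL LR by blast
    qed
  qed
  then obtain g where g: "inj_on g data"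
      "\<And>X. X \<in> data \<Longrightarrow> g X \<in> set_pmf (alice P (alice_sets X))"
    by blast
  \<comment> \<open>The cost is a supremum over full inputs, so some query must complete Alice's
    family to an instance.\<close>
  obtain e where e: "e \<in> E" using \<open>E \<noteq> {}\<close> by auto
  have "length (g X) \<le> T" if X: "X \<in> data" for X
  proof -
    have "enat (length (g X)) \<le> (SUP msg \<in> set_pmf (alice P (alice_sets X)). enat (length msg))"
      using g(2)[OF X] by (rule SUP_upper)
    also have "\<dots> \<le> comm_cost P U (Suc (card E))"
      unfolding comm_cost_def by (rule SUP_upper2[OF in_instances[OF X e]]) simp
    finally show ?thesis using enat by simp
  qed
  then have "card E * card R \<le> T"
    using length_ge_if_injective[OF g(1)] card_data by simp
  then show ?thesis using enat by simp
qed simp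

end

section \<open>Size of the label set and asymptotics\<close>

lemma comm_cost_lower_bound:
  assumes finU: "finite U" and k: "0 < k" and r: "card U = Suc (2 * k) + r"
    and m: "2 \<le> m" "m \<le> (2 * k) choose k"
    and approx: "approximates P U m \<alpha> \<epsilon>" and \<alpha>: "\<alpha> < 3 / 2"
    and small: "real (m - 1) * \<epsilon> < 1 / 2"
  shows "enat ((m - 1) * r) \<le> comm_cost P U m"
proof -
  obtain z where z: "z \<in> U" using r by fastforce
  have "2 * k \<le> card (U - {z})" using r z finU by simp
  then obtain L where L: "L \<subseteq> U - {z}" "card L = 2 * k"
    by (meson obtain_subset_with_card_n)
  have finL: "finite L" using L finU by (meson finite_Diff finite_subset)
  define R where "R = U - {z} - L"
  have cardR: "card R = r"
    unfolding R_def using L z r finU finL by (simp add: card_Diff_subset)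
  \<comment> \<open>Labels come from the middle layer of \<open>Pow L\<close>: sets of equal size
    form an antichain, and no layer is larger.\<close>
  have "card {e. e \<subseteq> L \<and> card e = k} = (2 * k) choose k"
    using n_subsets[OF finL] L(2) by simp
  then have "m - 1 \<le> card {e. e \<subseteq> L \<and> card e = k}" using m(2) by simp
  then obtain E where E: "E \<subseteq> {e. e \<subseteq> L \<and> card e = k}" "card E = m - 1"
    by (meson obtain_subset_with_card_n)
  interpret labelled_instance U L R z E
  proof
    show "d = e" if "d \<in> E" "e \<in> E" "e \<subseteq> d" for d e
    proof -
      have "d \<subseteq> L" "card d = card e" using that(1,2) E(1) by auto
      then show ?thesis
        using card_subset_eq[OF finite_subset[OF _ finL], of d e] that(3) by simp
    qed
  qed (use finU L z E k in \<open>auto simp: R_def\<close>)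
  have "Suc (card E) = m" "E \<noteq> {}" using E(2) m(1) by auto
  then show ?thesis
    using comm_cost_ge[of P \<alpha> \<epsilon>] approx \<alpha> small E(2) cardR by simp
qed

text \<open>\<open>\<beta>\<close> is the midpoint of \<open>1 / \<gamma>\<close> and 1: the gap
  below it absorbs the factor \<open>4 * n\<close> exponentially, and the gap above it leaves a
  linear share of the points for data.\<close>

lemma eventually_label_size:
  assumes "\<gamma> > (1::real)"
  defines "\<beta> \<equiv> (1 + 1 / \<gamma>) / 2"
  shows "\<forall>\<^sub>F n in sequentially. 4 * real n * 2 powr (real n / \<gamma>) \<le> 2 powr (\<beta> * real n)
    \<and> 4 \<le> \<beta> * real n \<and> 1 \<le> (1 - \<beta>) / 2 * real n"
proof -
  have \<beta>: "0 < \<beta>" "\<beta> < 1" and \<sigma>: "0 < \<beta> - 1 / \<gamma>"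
    using assms by (auto simp: field_simps)
  define \<sigma> where "\<sigma> = \<beta> - 1 / \<gamma>"
  have "\<sigma> > 0" using \<sigma> by (simp add: \<sigma>_def)
  then have "\<forall>\<^sub>F n in sequentially. 4 * real n \<le> 2 powr (\<sigma> * real n)"
    by real_asymp
  moreover have "\<forall>\<^sub>F n in sequentially. 4 \<le> \<beta> * real n"
    using \<beta> by real_asymp
  moreover have "\<forall>\<^sub>F n in sequentially. 1 \<le> (1 - \<beta>) / 2 * real n"
    using \<beta> by real_asymp
  ultimately show ?thesis
  proof eventually_elim
    case (elim n)
    have "4 * real n * 2 powr (real n / \<gamma>) \<le> 2 powr (\<sigma> * real n) * 2 powr (real n / \<gamma>)"
      using elim(1) by (intro mult_right_mono) auto
    also have "\<dots> = 2 powr (\<beta> * real n)"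
      by (simp add: \<sigma>_def algebra_simps flip: powr_add)
    finally show ?case using elim by blast
  qed
qed

text \<open>The central binomial coefficient is at least \<open>4 ^ k / (2 * k)\<close>. In
  \<open>big\<close>, the factor \<open>n\<close> pays for the denominator and the 4 for rounding
  \<open>\<beta> * n\<close> down to an even number.\<close>

lemma obtain_label_size:
  fixes \<beta> :: real
  assumes big: "4 * real n * real m \<le> 2 powr (\<beta> * real n)"
    and \<beta>: "4 \<le> \<beta> * real n" "\<beta> < 1"
  obtains k where "0 < k" "real (2 * k) \<le> \<beta> * real n" "m \<le> (2 * k) choose k"
proof -
  define k where "k = nat \<lfloor>\<beta> * real n / 2\<rfloor>"
  have k: "real (2 * k) \<le> \<beta> * real n" "\<beta> * real n - 2 \<le> real (2 * k)"
    unfolding k_def using \<beta>(1) by linarith+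
  have k0: "0 < k" using k \<beta>(1) by linarith
  have "\<beta> * real n \<le> 1 * real n" using \<beta>(2) by (intro mult_right_mono) auto
  then have kn: "real (2 * k) \<le> real n" using k by linarith
  have n0: "0 < n" using \<beta>(1) by (cases n) auto
  have "4 * real n * real m \<le> 2 powr (real (2 * k) + 2)"
    using big k(2) by (smt (verit) powr_mono)
  also have "\<dots> = 4 * 4 ^ k"
    by (simp add: powr_add powr_realpow power_mult flip: of_nat_mult)
  finally have "real n * real m \<le> 4 ^ k" by simp
  then have "real m \<le> 4 ^ k / real n"
    using n0 by (simp add: field_simps)
  also have "\<dots> \<le> 4 ^ k / (2 * real k)"
    using kn k0 by (intro divide_left_mono) auto
  also have "\<dots> \<le> real ((2 * k) choose k)"
    using central_binomial_lower_bound[OF k0] by simp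
  finally have "m \<le> (2 * k) choose k" by simp
  with k0 k(1) show thesis by (rule that)
qed

text \<open>Having \<open>m\<close> distinct subsets already requires \<open>log 2 m\<close> points;
  \<open>\<gamma> > 1\<close> provides the surplus that holds the data.\<close>

theorem theorem3p1:
  "\<exists>c0 > 0. \<forall>c \<ge> c0. \<forall>K > (0::real). \<forall>\<gamma> > (1::real). \<exists>\<delta> > (0::real). \<exists>m0 :: nat.
     \<forall>m \<ge> m0. \<forall>(U :: 'a set) (P :: 'a one_way_protocol) (\<alpha> :: real).
       finite U \<longrightarrow> real (card U) \<ge> \<gamma> * log 2 (real m) \<longrightarrow> \<alpha> < 3 / 2 \<longrightarrow>
       approximates P U m \<alpha> (K * real m powr (- c)) \<longrightarrow>
       ereal (\<delta> * real m * real (card U)) \<le> ereal_of_enat (comm_cost P U m)"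
proof (rule exI[of _ "2::real"], intro conjI allI impI)
  fix c K \<gamma> :: real
  assume c: "2 \<le> c" and K: "0 < K" and \<gamma>: "1 < \<gamma>"
  define \<beta> where "\<beta> = (1 + 1 / \<gamma>) / 2"
  have \<beta>: "\<beta> < 1" using \<gamma> by (simp add: \<beta>_def field_simps)
  obtain N where N: "\<And>n. n \<ge> N \<Longrightarrow> 4 * real n * 2 powr (real n / \<gamma>) \<le> 2 powr (\<beta> * real n)
    \<and> 4 \<le> \<beta> * real n \<and> 1 \<le> (1 - \<beta>) / 2 * real n"
    using eventually_label_size[OF \<gamma>] unfolding \<beta>_def eventually_sequentially by blast
  \<comment> \<open>\<open>2 ^ N\<close> forces \<open>card U\<close> to be at least
    \<open>N\<close>, 2 gives \<open>m - 1 \<ge> m / 2\<close>, and \<open>2 * K\<close> keeps the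
    total error, at most \<open>K / m\<close> as \<open>c \<ge> 2\<close>, below 1/2.\<close>
  define m0 where "m0 = max (2 ^ N) (max 2 (nat \<lceil>2 * K\<rceil> + 1))"
  show "\<exists>\<delta> > 0. \<exists>m0 :: nat.
     \<forall>m \<ge> m0. \<forall>(U :: 'a set) (P :: 'a one_way_protocol) (\<alpha> :: real).
       finite U \<longrightarrow> real (card U) \<ge> \<gamma> * log 2 (real m) \<longrightarrow> \<alpha> < 3 / 2 \<longrightarrow>
       approximates P U m \<alpha> (K * real m powr (- c)) \<longrightarrow>
       ereal (\<delta> * real m * real (card U)) \<le> ereal_of_enat (comm_cost P U m)"
  \<comment> \<open>One factor 1/2 is lost in passing from \<open>m\<close> to \<open>m - 1\<close>,
    the other in the share \<open>(1 - \<beta>) / 2\<close> of the points kept for data.\<close>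
  proof (intro exI[of _ "(1 - \<beta>) / 4"] exI[of _ m0] conjI allI impI)
    show "0 < (1 - \<beta>) / 4" using \<beta> by simp
  next
    fix m :: nat and U :: "'a set" and P :: "'a one_way_protocol" and \<alpha> :: real
    assume m: "m0 \<le> m" and finU: "finite U" and n: "\<gamma> * log 2 (real m) \<le> real (card U)"
      and \<alpha>: "\<alpha> < 3 / 2" and approx: "approximates P U m \<alpha> (K * real m powr (- c))"
    define n where "n = card U"
    have m2: "2 \<le> m" and mN: "2 ^ N \<le> m" and mK: "2 * K < real m"
      using m unfolding m0_def by (auto, linarith)
    have "2 ^ N \<le> real m"
      using mN by (metis of_nat_le_iff of_nat_numeral of_nat_power)
    then have logN: "real N \<le> log 2 (real m)"
      using m2 by (simp add: le_log_iff powr_realpow)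
    have "real N \<le> \<gamma> * log 2 (real m)"
      using \<gamma> logN mult_right_mono[of 1 \<gamma> "log 2 (real m)"] by simp
    then have "N \<le> n" using n unfolding n_def by linarith
    from N[OF this] have big: "4 * real n * 2 powr (real n / \<gamma>) \<le> 2 powr (\<beta> * real n)"
      and \<beta>n: "4 \<le> \<beta> * real n" and room: "1 \<le> (1 - \<beta>) / 2 * real n" by auto
    have "real m = 2 powr log 2 (real m)" using m2 by simp
    also have "\<dots> \<le> 2 powr (real n / \<gamma>)"
      using n \<gamma> by (intro powr_mono) (auto simp: n_def field_simps)
    finally have "4 * real n * real m \<le> 4 * real n * 2 powr (real n / \<gamma>)"
      by (intro mult_left_mono) auto
    with big have "4 * real n * real m \<le> 2 powr (\<beta> * real n)" by linarith
    then obtain k where k: "0 < k" "real (2 * k) \<le> \<beta> * real n" "m \<le> (2 * k) choose k"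
      using obtain_label_size[OF _ \<beta>n \<beta>] by blast
    \<comment> \<open>At least \<open>(1 - \<beta>) * n\<close> points lie outside the labels; half
      of that amount goes to data, and the other half pays for \<open>z\<close>.\<close>
    have slack: "real (2 * k) + 1 + (1 - \<beta>) / 2 * real n \<le> real n"
      using k(2) room by (simp add: algebra_simps add_divide_distrib diff_divide_distrib)
    then have kn: "Suc (2 * k) \<le> card U" using room by (simp add: n_def)
    define r where "r = card U - Suc (2 * k)"
    have r: "card U = Suc (2 * k) + r" using kn by (simp add: r_def)
    have r_ge: "(1 - \<beta>) / 2 * real n \<le> real r" using slack r by (simp add: n_def)
    have "real (m - 1) * (K * real m powr (- c)) \<le> real m * (K * real m powr (- 2))"
      using c m2 K by (intro mult_mono powr_mono) auto
    also have "\<dots> = K / real m"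
      using m2 by (simp add: powr_minus powr_numeral power2_eq_square field_simps)
    also have "\<dots> < 1 / 2" using mK m2 by (simp add: field_simps)
    finally have small: "real (m - 1) * (K * real m powr (- c)) < 1 / 2" .
    have "(1 - \<beta>) / 4 * real m * real n = real m / 2 * ((1 - \<beta>) / 2 * real n)" by simp
    also have "\<dots> \<le> real (m - 1) * real r"
      using m2 r_ge room by (intro mult_mono) auto
    finally have "ereal ((1 - \<beta>) / 4 * real m * real (card U)) \<le> ereal_of_enat (enat ((m - 1) * r))"
      by (simp add: n_def)
    also have "\<dots> \<le> ereal_of_enat (comm_cost P U m)"
      using comm_cost_lower_bound[OF finU k(1) r m2 k(3) approx \<alpha> small]
      by (simp only: ereal_of_enat_le_iff)
    finally show "ereal ((1 - \<beta>) / 4 * real m * real (card U)) \<le> ereal_of_enat (comm_cost P U m)" .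
  qed
qed simp

end
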